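(* Let $\mathcal C$ be a class of functions $M\colon G\to\mathbb C$ such that if $M,N\in\mathcal C$, then $M+\alpha N\in\mathcal C$ for every $\alpha\in\mathbb C$. If $M\in\mathcal C$ is such that $\beta(M)\ge\beta(N)$ for each $N\in\mathcal C$, then $M$ must also satisfy $$\Psi_M\overline{\Psi_{M,N}}=\Psi_N\Psi_{M,M}\quad\text{for each }N\in\mathcal C.$$
   Context: $G$ is an (indexing) set, $L\colon G\to\mathbb C$ is a function, and $w\colon G\to[0,\infty)$ is a weight function, not identically $0$. For $f\colon G\to\mathbb C$ put $\mathbb E^w_{\pi\in G}f(\pi):=\frac{\sum_{\pi\in G}w(\pi)f(\pi)}{\sum_{\pi\in G}w(\pi)}$. For $M,N\colon G\to\mathbb C$ define $\Psi_M:=\mathbb E^w_{\pi\in G}L(\pi)M(\pi)$, $\Psi_{M,N}:=\mathbb E^w_{\pi\in G}L(\pi)M(\pi)\overline{L(\pi)N(\pi)}$, and $\beta(M):=|\Psi_M|^2/\Psi_{M,M}$ if $\Psi_{M,M}\ne0$, $\beta(M):=0$ if $\Psi_{M,M}=0$. It is assumed that the series $\sum_\pi w(\pi)$ and $\sum_\pi w(\pi)|L(\pi)M(\pi)|^2$ converge for every function $M$ considered (automatic if $G$ is finite). *)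

theory Defs
  imports "HOL-Analysis.Analysis"
begin

text \<open>
  The indexing set is an arbitrary set \<open>G\<close> of elements of a type; functions on \<open>G\<close> are total functions
  of which only the values on \<open>G\<close> enter the definitions. Series over \<open>G\<close> are unconditional sums
  \<^const>\<open>infsum\<close>, so \<open>G\<close> may be infinite. These sums, and hence the quantities below, are meaningful
  only under the summability assumptions, which are made explicit where they are used.
\<close>

definition wmean :: "'g set \<Rightarrow> ('g \<Rightarrow> real) \<Rightarrow> ('g \<Rightarrow> complex) \<Rightarrow> complex" where
  "wmean G w f = (\<Sum>\<^sub>\<infinity>\<pi>\<in>G. complex_of_real (w \<pi>) * f \<pi>) / complex_of_real (\<Sum>\<^sub>\<infinity>\<pi>\<in>G. w \<pi>)"

definition Psi1 :: "'g set \<Rightarrow> ('g \<Rightarrow> real) \<Rightarrow> ('g \<Rightarrow> complex) \<Rightarrow> ('g \<Rightarrow> complex) \<Rightarrow> complex" where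
  "Psi1 G w L M = wmean G w (\<lambda>\<pi>. L \<pi> * M \<pi>)"

definition Psi2 ::
  "'g set \<Rightarrow> ('g \<Rightarrow> real) \<Rightarrow> ('g \<Rightarrow> complex) \<Rightarrow> ('g \<Rightarrow> complex) \<Rightarrow> ('g \<Rightarrow> complex) \<Rightarrow> complex" where
  "Psi2 G w L M N = wmean G w (\<lambda>\<pi>. L \<pi> * M \<pi> * cnj (L \<pi> * N \<pi>))"

text \<open>
  \<open>Psi2 G w L M M\<close> is a real number for every real weight, see \<open>Psi2_self_real\<close> below; \<^const>\<open>Re\<close> only
  serves to make the quotient real-valued, so that values can be compared.
\<close>

definition beta :: "'g set \<Rightarrow> ('g \<Rightarrow> real) \<Rightarrow> ('g \<Rightarrow> complex) \<Rightarrow> ('g \<Rightarrow> complex) \<Rightarrow> real" where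
  "beta G w L M =
    (if Psi2 G w L M M = 0 then 0 else (cmod (Psi1 G w L M))\<^sup>2 / Re (Psi2 G w L M M))"

lemma Psi2_self_real: "Psi2 G w L M M \<in> \<real>"
  unfolding Reals_cnj_iff Psi2_def wmean_def
  by (simp only: complex_cnj_divide infsum_cnj [symmetric] complex_cnj_mult complex_cnj_cnj
      complex_cnj_complex_of_real mult_ac)

lemma of_real_beta:
  "Psi2 G w L M M \<noteq> 0 \<Longrightarrow>
    complex_of_real (beta G w L M) = complex_of_real ((cmod (Psi1 G w L M))\<^sup>2) / Psi2 G w L M M"
  by (simp add: beta_def of_real_Re Psi2_self_real)

end

theory Submission
  imports Defs
begin

text \<open>
  Put \<open>B = \<beta>(M)\<close>. Maximality says that the Hermitian form
  \<open>H(K, N) = B \<Psi>\<^bsub>K,N\<^esub> - \<Psi>\<^bsub>K\<^esub> cnj \<Psi>\<^bsub>N\<^esub>\<close> is nonnegative on the diagonal of \<open>\<C>\<close>: if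
  \<open>\<Psi>\<^bsub>K,K\<^esub> = 0\<close>, then \<open>w L K\<close> vanishes on \<open>G\<close> and so \<open>\<Psi>\<^bsub>K\<^esub> = 0\<close>. Since \<open>H(M, M) = 0\<close>,
  expanding \<open>H(M + \<alpha> N, M + \<alpha> N) \<ge> 0\<close> for all \<open>\<alpha>\<close> forces \<open>H(M, N) = 0\<close>, that is,
  \<open>B \<Psi>\<^bsub>M,N\<^esub> = \<Psi>\<^bsub>M\<^esub> cnj \<Psi>\<^bsub>N\<^esub>\<close>. Multiply by \<open>\<Psi>\<^bsub>M,M\<^esub>\<close> and cancel \<open>\<Psi>\<^bsub>M\<^esub>\<close>; if \<open>\<Psi>\<^bsub>M\<^esub> = 0\<close>,
  then \<open>B = 0\<close> and every \<open>\<Psi>\<^bsub>N\<^esub>\<close> vanishes.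
\<close>

lemma wmean_add_scale:
  assumes "(\<lambda>x. complex_of_real (w x) * f x) summable_on G"
    and "(\<lambda>x. complex_of_real (w x) * g x) summable_on G"
  shows "wmean G w (\<lambda>x. f x + a * g x) = wmean G w f + a * wmean G w g"
proof -
  have "(\<Sum>\<^sub>\<infinity>x\<in>G. complex_of_real (w x) * (f x + a * g x))
      = (\<Sum>\<^sub>\<infinity>x\<in>G. complex_of_real (w x) * f x + a * (complex_of_real (w x) * g x))"
    by (simp add: algebra_simps)
  also have "\<dots> = (\<Sum>\<^sub>\<infinity>x\<in>G. complex_of_real (w x) * f x)
      + a * (\<Sum>\<^sub>\<infinity>x\<in>G. complex_of_real (w x) * g x)"
    using assms by (simp add: infsum_add summable_on_cmult_right infsum_cmult_right)
  finally show ?thesis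
    by (simp add: wmean_def add_divide_distrib)
qed

lemma wmean_cnj: "wmean G w (\<lambda>x. cnj (f x)) = cnj (wmean G w f)"
  by (simp add: wmean_def flip: infsum_cnj)

text \<open>By 2|fg| \<le> |f|^2 + |g|^2, the weighted squares dominate the product. This makes
  \<open>Psi2\<close> a convergent series.\<close>

lemma weighted_summable_mult_cnj:
  fixes f g :: "'g \<Rightarrow> complex"
  assumes w: "\<And>x. x \<in> G \<Longrightarrow> w x \<ge> 0"
    and f: "(\<lambda>x. w x * (cmod (f x))\<^sup>2) summable_on G"
    and g: "(\<lambda>x. w x * (cmod (g x))\<^sup>2) summable_on G"
  shows "(\<lambda>x. complex_of_real (w x) * (f x * cnj (g x))) summable_on G"
proof (rule abs_summable_summable, rule Infinite_Sum.abs_summable_on_comparison_test')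
  show "(\<lambda>x. w x * (cmod (f x))\<^sup>2 + w x * (cmod (g x))\<^sup>2) summable_on G"
    using f g by (rule summable_on_add)
  fix x assume "x \<in> G"
  have "2 * (cmod (f x) * cmod (g x)) \<le> (cmod (f x))\<^sup>2 + (cmod (g x))\<^sup>2"
    using sum_squares_bound[of "cmod (f x)" "cmod (g x)"] by simp
  moreover have "0 \<le> cmod (f x) * cmod (g x)"
    by simp
  ultimately have "cmod (f x) * cmod (g x) \<le> (cmod (f x))\<^sup>2 + (cmod (g x))\<^sup>2"
    by linarith
  from mult_left_mono[OF this w[OF \<open>x \<in> G\<close>]]
  show "norm (complex_of_real (w x) * (f x * cnj (g x)))
      \<le> w x * (cmod (f x))\<^sup>2 + w x * (cmod (g x))\<^sup>2"
    using w[OF \<open>x \<in> G\<close>] by (simp add: norm_mult distrib_left)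
qed

text \<open>With finite total weight the constant 1 is square summable, so it can serve as the
  second factor.\<close>

lemma weighted_summable:
  fixes f :: "'g \<Rightarrow> complex"
  assumes "\<And>x. x \<in> G \<Longrightarrow> w x \<ge> 0" and "w summable_on G"
    and "(\<lambda>x. w x * (cmod (f x))\<^sup>2) summable_on G"
  shows "(\<lambda>x. complex_of_real (w x) * f x) summable_on G"
  using weighted_summable_mult_cnj[of G w f "\<lambda>_. 1"] assms by simp

lemma Psi1_add_scale:
  assumes "\<And>x. x \<in> G \<Longrightarrow> w x \<ge> 0" and "w summable_on G"
    and "(\<lambda>x. w x * (cmod (L x * M x))\<^sup>2) summable_on G"
    and "(\<lambda>x. w x * (cmod (L x * N x))\<^sup>2) summable_on G"
  shows "Psi1 G w L (\<lambda>x. M x + a * N x) = Psi1 G w L M + a * Psi1 G w L N"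
proof -
  have "Psi1 G w L (\<lambda>x. M x + a * N x) = wmean G w (\<lambda>x. L x * M x + a * (L x * N x))"
    by (simp add: Psi1_def algebra_simps)
  also have "\<dots> = Psi1 G w L M + a * Psi1 G w L N"
    unfolding Psi1_def by (intro wmean_add_scale weighted_summable assms)
  finally show ?thesis .
qed

lemma Psi2_commute: "Psi2 G w L N M = cnj (Psi2 G w L M N)"
  unfolding Psi2_def wmean_cnj[symmetric] by (simp add: mult_ac)

lemma Psi2_add_scale_left:
  assumes "\<And>x. x \<in> G \<Longrightarrow> w x \<ge> 0"
    and "(\<lambda>x. w x * (cmod (L x * M x))\<^sup>2) summable_on G"
    and "(\<lambda>x. w x * (cmod (L x * N x))\<^sup>2) summable_on G"
    and "(\<lambda>x. w x * (cmod (L x * K x))\<^sup>2) summable_on G"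
  shows "Psi2 G w L (\<lambda>x. M x + a * N x) K = Psi2 G w L M K + a * Psi2 G w L N K"
proof -
  have "Psi2 G w L (\<lambda>x. M x + a * N x) K
      = wmean G w (\<lambda>x. L x * M x * cnj (L x * K x) + a * (L x * N x * cnj (L x * K x)))"
    unfolding Psi2_def by (simp add: algebra_simps)
  also have "\<dots> = Psi2 G w L M K + a * Psi2 G w L N K"
    unfolding Psi2_def by (intro wmean_add_scale weighted_summable_mult_cnj assms)
  finally show ?thesis .
qed

text \<open>No summability is assumed: both series converge or both take the default value
  0.\<close>

lemma infsum_complex_of_real:
  "(\<Sum>\<^sub>\<infinity>x\<in>A. complex_of_real (f x)) = complex_of_real (\<Sum>\<^sub>\<infinity>x\<in>A. f x)"
proof (rule infsum_bounded_linear_strong)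
  show "(\<lambda>x. complex_of_real (f x)) summable_on A \<longleftrightarrow> f summable_on A"
    using summable_on_Re[of "\<lambda>x. complex_of_real (f x)" A] summable_on_of_real by auto
qed (rule bounded_linear_of_real)

lemma Psi2_self:
  "Psi2 G w L M M
    = complex_of_real ((\<Sum>\<^sub>\<infinity>x\<in>G. w x * (cmod (L x * M x))\<^sup>2) / (\<Sum>\<^sub>\<infinity>x\<in>G. w x))"
proof -
  have "complex_of_real (w x) * (L x * M x * cnj (L x * M x))
      = complex_of_real (w x * (cmod (L x * M x))\<^sup>2)" for x
    by (simp only: of_real_mult complex_norm_square)
  then show ?thesis
    by (simp only: Psi2_def wmean_def infsum_complex_of_real of_real_divide)
qed

lemma Psi2_self_nonneg:
  assumes "\<And>x. x \<in> G \<Longrightarrow> w x \<ge> 0"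
  shows "Re (Psi2 G w L M M) \<ge> 0"
  unfolding Psi2_self Re_complex_of_real
  by (intro divide_nonneg_nonneg infsum_nonneg) (simp_all add: assms)

text \<open>A vanishing sum of nonnegative terms has only zero terms, so at each point the weight or
  \<open>L x * M x\<close> is 0.\<close>

lemma Psi1_eq_0_if_Psi2_self_eq_0:
  assumes w: "\<And>x. x \<in> G \<Longrightarrow> w x \<ge> 0"
    and M: "(\<lambda>x. w x * (cmod (L x * M x))\<^sup>2) summable_on G"
    and "Psi2 G w L M M = 0"
  shows "Psi1 G w L M = 0"
proof (cases "(\<Sum>\<^sub>\<infinity>x\<in>G. w x) = 0")
  \<comment> \<open>Division by zero yields 0, so every \<open>wmean\<close> is 0 here.\<close>
  case True
  then show ?thesis
    by (simp add: Psi1_def wmean_def)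
next
  case False
  then have "(\<Sum>\<^sub>\<infinity>x\<in>G. w x * (cmod (L x * M x))\<^sup>2) = 0"
    using assms(3) by (simp add: Psi2_self)
  then have "w x * (cmod (L x * M x))\<^sup>2 = 0" if "x \<in> G" for x
    using nonneg_infsum_le_0D[OF _ M _ that] w by simp
  then have "complex_of_real (w x) * (L x * M x) = 0" if "x \<in> G" for x
    using that by fastforce
  then have "(\<Sum>\<^sub>\<infinity>x\<in>G. complex_of_real (w x) * (L x * M x)) = 0"
    by (rule infsum_0)
  then show ?thesis
    by (simp add: Psi1_def wmean_def)
qed

text \<open>A division-free form of \<open>beta\<close> that also covers its default value, since
  \<open>Psi1\<close> vanishes whenever the denominator does.\<close>

lemma cmod_Psi1_squared:
  assumes "\<And>x. x \<in> G \<Longrightarrow> w x \<ge> 0"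
    and "(\<lambda>x. w x * (cmod (L x * M x))\<^sup>2) summable_on G"
  shows "(cmod (Psi1 G w L M))\<^sup>2 = beta G w L M * Re (Psi2 G w L M M)"
proof (cases "Psi2 G w L M M = 0")
  case True
  then show ?thesis
    using Psi1_eq_0_if_Psi2_self_eq_0[OF assms] by simp
next
  case False
  then have "Re (Psi2 G w L M M) \<noteq> 0"
    by (simp add: Psi2_self)
  with False show ?thesis
    by (simp add: beta_def)
qed

text \<open>For small \<alpha> pointing along \<open>- cnj z\<close> the linear term is negative and
  outweighs the quadratic one.\<close>

lemma complex_quadratic_nonneg_imp_linear_eq_0:
  assumes "\<And>\<alpha>. 0 \<le> 2 * Re (\<alpha> * z) + (cmod \<alpha>)\<^sup>2 * k"
  shows "z = 0"
proof (rule ccontr)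
  assume "z \<noteq> 0"
  \<comment> \<open>The step size ensures \<open>t * k < 1\<close> for either sign of k, and also
    for k = 0.\<close>
  define t where "t = 1 / (\<bar>k\<bar> + 1)"
  have t: "t > 0" "t * k < 1"
    by (auto simp: t_def field_simps)
  have "Re (- complex_of_real t * cnj z * z) = - t * (cmod z)\<^sup>2"
    by (simp only: cmod_power2) (simp add: algebra_simps power2_eq_square)
  moreover have "(cmod (- complex_of_real t * cnj z))\<^sup>2 = t\<^sup>2 * (cmod z)\<^sup>2"
    by (simp add: norm_mult power_mult_distrib)
  ultimately have "0 \<le> t * (cmod z)\<^sup>2 * (t * k - 2)"
    using assms[of "- complex_of_real t * cnj z"]
    by (simp add: algebra_simps power2_eq_square)
  moreover have "t * (cmod z)\<^sup>2 * (t * k - 2) < 0"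
    using t \<open>z \<noteq> 0\<close> by (intro mult_pos_neg) simp_all
  ultimately show False
    by simp
qed

theorem corollary2p7:
  fixes G :: "'g set" and L :: "'g \<Rightarrow> complex" and w :: "'g \<Rightarrow> real"
    and \<C> :: "('g \<Rightarrow> complex) set" and M :: "'g \<Rightarrow> complex"
  assumes w_nonneg: "\<And>\<pi>. \<pi> \<in> G \<Longrightarrow> w \<pi> \<ge> 0"
    and w_nonzero: "\<exists>\<pi>\<in>G. w \<pi> \<noteq> 0"
    and w_summable: "w summable_on G"
    and LM_summable: "\<And>N. N \<in> \<C> \<Longrightarrow> (\<lambda>\<pi>. w \<pi> * (cmod (L \<pi> * N \<pi>))\<^sup>2) summable_on G"
    and closed: "\<And>N K \<alpha>. N \<in> \<C> \<Longrightarrow> K \<in> \<C> \<Longrightarrow> (\<lambda>\<pi>. N \<pi> + \<alpha> * K \<pi>) \<in> \<C>"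
    and M_in: "M \<in> \<C>"
    and M_max: "\<And>N. N \<in> \<C> \<Longrightarrow> beta G w L M \<ge> beta G w L N"
  shows "\<forall>N\<in>\<C>. Psi1 G w L M * cnj (Psi2 G w L M N) = Psi1 G w L N * Psi2 G w L M M"
proof
  fix N assume N: "N \<in> \<C>"
  define B where "B = beta G w L M"
  define P where "P = Psi1 G w L M"
  define Q where "Q = Psi1 G w L N"
  define A where "A = Re (Psi2 G w L M M)"
  define b where "b = Psi2 G w L M N"
  define c where "c = Re (Psi2 G w L N N)"
  have A: "Psi2 G w L M M = complex_of_real A" and c: "Psi2 G w L N N = complex_of_real c"
    by (simp_all add: A_def c_def Psi2_self_real)
  have BA: "(cmod P)\<^sup>2 = B * A"
    unfolding P_def B_def A_def
    using w_nonneg LM_summable[OF M_in] by (rule cmod_Psi1_squared)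
  have bound: "(cmod (Psi1 G w L K))\<^sup>2 \<le> B * Re (Psi2 G w L K K)" if "K \<in> \<C>" for K
    using cmod_Psi1_squared[OF w_nonneg LM_summable[OF that]]
      mult_right_mono[OF M_max[OF that] Psi2_self_nonneg[OF w_nonneg]]
    by (simp add: B_def)
  \<comment> \<open>Settled separately because \<open>cnj P\<close> is cancelled at the end. If
    \<open>A = 0\<close>, both sides vanish.\<close>
  have zero: "P * cnj b = Q * Psi2 G w L M M" if "P = 0"
  proof (cases "A = 0")
    case False
    then have "B = 0"
      using BA that by simp
    then have "Q = 0"
      using bound[OF N] by (simp add: Q_def)
    then show ?thesis
      using that by simp
  qed (simp add: A that)
  \<comment> \<open>The left side is the conjugate of H(M, N), which is the coefficient of \<alpha>
    in the expansion.\<close>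
  have "complex_of_real B * cnj b - cnj P * Q = 0"
  proof (rule complex_quadratic_nonneg_imp_linear_eq_0)
    fix \<alpha>
    let ?K = "\<lambda>x. M x + \<alpha> * N x"
    have K: "?K \<in> \<C>"
      by (intro closed M_in N)
    note sm = LM_summable[OF M_in] LM_summable[OF N] LM_summable[OF K]
    have 1: "Psi1 G w L ?K = P + \<alpha> * Q"
      unfolding P_def Q_def by (intro Psi1_add_scale w_nonneg w_summable sm)
    \<comment> \<open>Conjugate linearity in the second argument comes from linearity in the first
      by Hermitian symmetry.\<close>
    have "Psi2 G w L M ?K = A + cnj \<alpha> * b" "Psi2 G w L N ?K = cnj b + cnj \<alpha> * c"
      using Psi2_add_scale_left[where K = M and M = M and N = N and a = \<alpha>, OF w_nonneg]
        Psi2_add_scale_left[where K = N and M = M and N = N and a = \<alpha>, OF w_nonneg] sm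
      by (simp_all add: Psi2_commute[of G w L _ ?K] Psi2_commute[of G w L N M] A c b_def)
    then have 2: "Psi2 G w L ?K ?K = A + cnj \<alpha> * b + \<alpha> * (cnj b + cnj \<alpha> * c)"
      using Psi2_add_scale_left[where K = ?K and M = M and N = N and a = \<alpha>, OF w_nonneg] sm
      by simp
    have "(cmod (P + \<alpha> * Q))\<^sup>2 \<le> B * Re (A + cnj \<alpha> * b + \<alpha> * (cnj b + cnj \<alpha> * c))"
      using bound[OF K] by (simp only: 1 2)
    \<comment> \<open>The constant term \<open>B * A - (cmod P)\<^sup>2\<close> drops out by
      \<open>BA\<close>, which expresses H(M, M) = 0.\<close>
    then show "0 \<le> 2 * Re (\<alpha> * (complex_of_real B * cnj b - cnj P * Q))
        + (cmod \<alpha>)\<^sup>2 * (B * c - (cmod Q)\<^sup>2)"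
      using BA unfolding cmod_power2 by (simp add: algebra_simps power2_eq_square)
  qed
  then have "complex_of_real A * (complex_of_real B * cnj b) = complex_of_real A * (cnj P * Q)"
    by simp
  moreover have "complex_of_real A * complex_of_real B = cnj P * P"
    using BA by (metis complex_norm_square mult.commute of_real_mult)
  ultimately have "cnj P * (P * cnj b) = cnj P * (Q * Psi2 G w L M M)"
    by (simp add: A mult_ac)
  then have "P * cnj b = Q * Psi2 G w L M M"
    using zero by (cases "P = 0") simp_all
  then show "Psi1 G w L M * cnj (Psi2 G w L M N) = Psi1 G w L N * Psi2 G w L M M"
    by (simp only: P_def Q_def b_def)
qed

end
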